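(* Let $l_1,l_2$ and $t$ be positive integers such that $l=\min(l_1,l_2)\geq t+2$. Then there exists a constant $n_0=n_0(l_1,l_2,t)$ depending only on $l_1,l_2$ and $t$ such that the following holds for all $n_1,n_2\geq n_0$: if families $\mathcal A_1\subseteq P(n_1,l_1)$ and $\mathcal A_2\subseteq P(n_2,l_2)$ are $2$-cross $t$-intersecting, then \[ |\mathcal A_1|\,|\mathcal A_2|\leq \binom{n_1+l_1-t-1}{l_1-t-1}\binom{n_2+l_2-t-1}{l_2-t-1}. \] Moreover, equality holds if and only if there is a $t$-element subset $T$ of $\{1,2,\dots,l\}$ such that $\mathcal A_1=\{\mathbf u\in P(n_1,l_1) : \mathbf u(i)=0 \text{ for all } i\in T\}$ and $\mathcal A_2=\{\mathbf u\in P(n_2,l_2) : \mathbf u(i)=0 \text{ for all } i\in T\}$.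
   Context: $\mathbb N_0$ denotes the set of non-negative integers. For positive integers $n,l$, $P(n,l)=\{(x_1,\dots,x_l)\in\mathbb N_0^l : x_1+\cdots+x_l=n\}$ is the set of weak compositions of $n$ with $l$ parts; for $\mathbf u=(u_1,\dots,u_l)\in P(n,l)$, $\mathbf u(i)=u_i$ denotes its $i$-th coordinate. For $\mathbf u_1\in P(n_1,l_1)$, $\mathbf u_2\in P(n_2,l_2)$ and $l=\min(l_1,l_2)$, let $I(\mathbf u_1,\mathbf u_2)=\{i\in\{1,\dots,l\} : \mathbf u_1(i)=\mathbf u_2(i)\}$. Families $\mathcal A_1\subseteq P(n_1,l_1)$, $\mathcal A_2\subseteq P(n_2,l_2)$ are $2$-cross $t$-intersecting if $|I(\mathbf u_1,\mathbf u_2)|\ge t$ for all $\mathbf u_1\in\mathcal A_1$, $\mathbf u_2\in\mathcal A_2$. *)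

theory Defs
  imports Complex_Main
begin

definition weak_compositions :: "nat \<Rightarrow> nat \<Rightarrow> nat list set" where
  "weak_compositions n l = {u. length u = l \<and> sum_list u = n}"

(* 1-based coordinates u(1), ..., u(l); used only for 1 \<le> i \<le> length u. *)
definition coord :: "nat list \<Rightarrow> nat \<Rightarrow> nat" where
  "coord u i = u ! (i - 1)"

(* For u \<in> weak_compositions n l the length of u is l, so the index range is {1..min l1 l2}. *)
definition agreement_set :: "nat list \<Rightarrow> nat list \<Rightarrow> nat set" where
  "agreement_set u v = {i \<in> {1..min (length u) (length v)}. coord u i = coord v i}"

definition cross_intersecting :: "nat \<Rightarrow> nat list set \<Rightarrow> nat list set \<Rightarrow> bool" where
  "cross_intersecting t A B \<longleftrightarrow> (\<forall>u\<in>A. \<forall>v\<in>B. card (agreement_set u v) \<ge> t)"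

end

(*
  Let N be the number of weak compositions of n1 into l1 - t - 1 parts, which bounds the number of
  members of P(n1, l1) with t + 1 prescribed coordinates. Call (T, w), with |T| = t, fat for A1 if more
  than l * N members of A1 agree with w on T. Then every v in A2 agrees with w on T: otherwise each of
  these members would share a coordinate outside T with v, and at most l * N of them do.
  If A1 has no fat pair, then covering A1 by the t-subsets of the coordinates of a single v in A2 gives
  |A1| = O(n1^(l1-t-2)), while |A2| = O(n2^(l2-t-1)), so the product is too small; likewise for A2.
  If both families have a fat pair, the two pairs must coincide, because a second one would fix at least
  t + 1 coordinates on a fat part. Hence both families lie in the cylinder of one pair (T, w), and such
  cylinders are largest exactly for w = 0.
*)

theory Submission
  imports Defs
begin

section \<open>Cylinders (compositions with prescribed coordinates) and their sizes\<close>

definition cylinder :: "nat \<Rightarrow> nat \<Rightarrow> nat set \<Rightarrow> (nat \<Rightarrow> nat) \<Rightarrow> nat list set" where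
  "cylinder n l T w = {u \<in> weak_compositions n l. \<forall>i\<in>T. u ! i = w i}"

text \<open>Positions count from 0 here and in \<open>cylinder\<close>, unlike in
  \<open>agreement_set\<close>. With the cutoff as a parameter, one l serves both families.\<close>

definition agreements :: "nat \<Rightarrow> nat list \<Rightarrow> nat list \<Rightarrow> nat set" where
  "agreements l u v = {i. i < l \<and> u ! i = v ! i}"

lemma card_weak_compositions:
  assumes "m > 0"
  shows "card (weak_compositions n m) = (n + (m - 1)) choose (m - 1)"
proof -
  have "card (weak_compositions n m) = (n + m - 1) choose n"
    unfolding weak_compositions_def using card_length_sum_list[of m n] by simp
  also have "\<dots> = (n + (m - 1)) choose (m - 1)"
    using assms binomial_symmetric[of n "n + (m - 1)"] by simp
  finally show ?thesis .
qed

lemma finite_weak_compositions: "finite (weak_compositions n l)"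
proof (rule finite_subset)
  show "weak_compositions n l \<subseteq> {u. set u \<subseteq> {..n} \<and> length u = l}"
    by (auto simp: weak_compositions_def dest: member_le_sum_list)
  show "finite {u. set u \<subseteq> {..n} \<and> length u = l}"
    by (rule finite_lists_length_eq) simp
qed

lemma finite_cylinder: "finite (cylinder n l T w)"
  by (rule finite_subset[OF _ finite_weak_compositions[of n l]]) (auto simp: cylinder_def)

lemma sum_list_split:
  fixes u :: "nat list"
  assumes "T \<subseteq> {..<length u}"
  shows "sum_list u = (\<Sum>i\<in>T. u ! i) + (\<Sum>i\<in>{..<length u} - T. u ! i)"
  using sum.subset_diff[OF assms, of "(!) u"]
  by (simp add: sum_list_sum_nth atLeast0LessThan add.commute)

text \<open>Deleting the coordinates in T leaves an arbitrary composition of the remaining total.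
  The bound on \<open>sum w T\<close> keeps the subtraction from truncating, so that deletion can be
  undone.\<close>

lemma card_cylinder_eq_weak_compositions:
  assumes T: "T \<subseteq> {..<l}" and w: "sum w T \<le> n"
  shows "card (cylinder n l T w) = card (weak_compositions (n - sum w T) (l - card T))"
proof -
  define m where "m = l - card T"
  have "card ({..<l} - T) = m"
    using T by (simp add: m_def card_Diff_subset finite_subset)
  \<comment> \<open>g enumerates the free positions and h below inverts it; F reads off the free
    entries, G puts them back and fills T from w.\<close>
  then obtain g where g: "bij_betw g {..<m} ({..<l} - T)"
    using ex_bij_betw_nat_finite[of "{..<l} - T"] by (auto simp: atLeast0LessThan)
  define h where "h = inv_into {..<m} g"
  have hg: "h (g j) = j" if "j < m" for j
    using g that by (simp add: h_def bij_betw_def)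
  have gh: "g (h i) = i" and h_less: "h i < m" if "i < l" "i \<notin> T" for i
    using that g bij_betw_inv_into_right[OF g, of i]
      inv_into_into[of i g "{..<m}"] by (auto simp: h_def bij_betw_def)
  have g_less: "g j < l" "g j \<notin> T" if "j < m" for j
    using g that by (auto simp: bij_betw_def)
  define F where "F = (\<lambda>u::nat list. map (\<lambda>j. u ! g j) [0..<m])"
  define G where "G = (\<lambda>v::nat list. map (\<lambda>i. if i \<in> T then w i else v ! h i) [0..<l])"
  have sum_F: "sum_list (F u) = (\<Sum>i\<in>{..<l} - T. u ! i)" for u
    using sum.reindex_bij_betw[OF g, of "(!) u"]
    by (simp add: F_def interv_sum_list_conv_sum_set_nat atLeast0LessThan)
  have FG: "F (G v) = v" if "length v = m" for v
    using that by (intro nth_equalityI) (auto simp: F_def G_def g_less hg)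
  have "bij_betw F (cylinder n l T w) (weak_compositions (n - sum w T) m)"
  proof (rule bij_betw_byWitness[where f' = G])
    show "\<forall>u\<in>cylinder n l T w. G (F u) = u"
      by (auto intro!: nth_equalityI simp: F_def G_def cylinder_def weak_compositions_def gh h_less)
    show "\<forall>v\<in>weak_compositions (n - sum w T) m. F (G v) = v"
      by (auto simp: FG weak_compositions_def)
    show "F ` cylinder n l T w \<subseteq> weak_compositions (n - sum w T) m"
    proof clarify
      fix u assume "u \<in> cylinder n l T w"
      then have u: "length u = l" "sum_list u = n" "(\<Sum>i\<in>T. u ! i) = sum w T"
        by (auto simp: cylinder_def weak_compositions_def)
      show "F u \<in> weak_compositions (n - sum w T) m"
        using sum_list_split[of T u] T u sum_F[of u] by (simp add: weak_compositions_def F_def)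
    qed
    show "G ` weak_compositions (n - sum w T) m \<subseteq> cylinder n l T w"
    proof clarify
      fix v assume "v \<in> weak_compositions (n - sum w T) m"
      then have v: "length v = m" "sum_list v = n - sum w T"
        by (auto simp: weak_compositions_def)
      have G_T: "\<forall>i\<in>T. G v ! i = w i"
        using T by (auto simp: G_def)
      have "sum_list (G v) = sum w T + sum_list (F (G v))"
        using sum_list_split[of T "G v"] T G_T sum_F[of "G v"] by (simp add: G_def)
      then show "G v \<in> cylinder n l T w"
        using G_T v w FG[OF v(1)] by (simp add: cylinder_def weak_compositions_def)
          (simp add: G_def)
    qed
  qed
  then show ?thesis
    by (simp add: bij_betw_same_card m_def)
qed

lemma card_cylinder:
  assumes "T \<subseteq> {..<l}" and "card T < l"
  shows "card (cylinder n l T w) =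
    (if sum w T \<le> n then (n - sum w T + (l - card T - 1)) choose (l - card T - 1) else 0)"
proof (cases "sum w T \<le> n")
  case True
  then show ?thesis
    using card_cylinder_eq_weak_compositions[OF assms(1) True] assms(2)
    by (simp add: card_weak_compositions)
next
  case False
  have "sum w T \<le> n" if "u \<in> cylinder n l T w" for u
    using sum_list_split[of T u] assms(1) that
    by (auto simp: cylinder_def weak_compositions_def)
  then have "cylinder n l T w = {}"
    using False by blast
  then show ?thesis
    using False by simp
qed

text \<open>By Pascal's rule, passing from n to n + 1 adds (n + k) choose (k - 1), which is
  positive.\<close>

lemma choose_shift_strict_mono:
  assumes "a < b" and "k > 0"
  shows "((a + k) choose k) < ((b + k) choose k)"
proof -
  obtain j where j: "k = Suc j"
    using assms(2) gr0_implies_Suc by blast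
  have "strict_mono (\<lambda>n. (n + k) choose k)"
    by (simp add: strict_mono_Suc_iff j)
  then show ?thesis
    using assms(1) by (rule strict_monoD)
qed

lemma choose_shift_mono: "a \<le> b \<Longrightarrow> ((a + k) choose k) \<le> ((b + k) choose k)"
  by (rule binomial_right_mono) simp

lemma card_cylinder_le:
  assumes "T \<subseteq> {..<l}" and "card T < l"
  shows "card (cylinder n l T w) \<le> (n + (l - card T - 1)) choose (l - card T - 1)"
  unfolding card_cylinder[OF assms] using choose_shift_mono[of "n - sum w T" n] by (metis diff_le_self le0)

text \<open>A nonzero prescribed value lowers the total left for the free coordinates. At least two
  of these remain, so the count drops strictly; with a single one it could stay at 1.\<close>

lemma card_cylinder_eq_max:
  assumes T: "T \<subseteq> {..<l}" and l: "card T + 2 \<le> l"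
    and "card (cylinder n l T w) \<ge> (n + (l - card T - 1)) choose (l - card T - 1)"
  shows "\<forall>i\<in>T. w i = 0"
proof (rule ccontr)
  assume "\<not> ?thesis"
  then have pos: "sum w T > 0"
    using T finite_subset by (fastforce simp: sum_nonneg_eq_0_iff)
  have "card (cylinder n l T w) < (n + (l - card T - 1)) choose (l - card T - 1)"
    using choose_shift_strict_mono[of "n - sum w T" n "l - card T - 1"] pos l
    by (auto simp: card_cylinder[OF T])
  then show False
    using assms(3) by simp
qed

text \<open>Forgetting all but t + 1 of the constraints only enlarges the cylinder. The bound has
  degree one less in n than the size of a cylinder on t coordinates.\<close>

lemma card_cylinder_more_le:
  assumes U: "U \<subseteq> {..<l}" and cU: "t < card U" and l: "t + 2 \<le> l"
  shows "card (cylinder n l U w) \<le> (n + (l - t - 2)) choose (l - t - 2)"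
proof -
  obtain V where V: "V \<subseteq> U" "card V = Suc t"
    using cU by (meson Suc_leI obtain_subset_with_card_n)
  have "card (cylinder n l U w) \<le> card (cylinder n l V w)"
    by (rule card_mono[OF finite_cylinder]) (use V in \<open>auto simp: cylinder_def\<close>)
  also have "\<dots> \<le> (n + (l - t - 2)) choose (l - t - 2)"
    using card_cylinder_le[of V l n w] V U l by (simp add: numeral_2_eq_2)
  finally show ?thesis .
qed

section \<open>Fat cylinders and coverings by cylinders\<close>

lemma fat_cylinder_forces:
  assumes l: "l \<le> l1" "t + 2 \<le> l" and S: "S \<subseteq> {..<l}" "card S = t"
    and fat: "card (A \<inter> cylinder n l1 S w) > l * ((n + (l1 - t - 2)) choose (l1 - t - 2))"
    and A: "\<forall>u\<in>A. t \<le> card (agreements l u v)"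
  shows "\<forall>i\<in>S. v ! i = w i"
proof (rule ccontr)
  assume neg: "\<not> ?thesis"
  have finS: "finite S"
    using S finite_subset by blast
  \<comment> \<open>Used only for i outside S, where it extends w by the value that u shares with
    v.\<close>
  let ?w = "\<lambda>i j. if j = i then v ! i else w j"
  have sub: "A \<inter> cylinder n l1 S w \<subseteq> (\<Union>i\<in>{..<l} - S. cylinder n l1 (insert i S) (?w i))"
  proof
    fix u assume u: "u \<in> A \<inter> cylinder n l1 S w"
    \<comment> \<open>At least t agreements inside the t-set S would fill S; then u, which equals w
      on S, would force v to equal w there.\<close>
    have "\<not> agreements l u v \<subseteq> S"
    proof
      assume sub: "agreements l u v \<subseteq> S"
      then have "agreements l u v = S"
        using A u S finS by (metis IntD1 card_seteq)
      then have "\<forall>i\<in>S. u ! i = v ! i"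
        by (auto simp: agreements_def)
      then show False
        using neg u by (auto simp: cylinder_def)
    qed
    then obtain i where "i < l" "i \<notin> S" "u ! i = v ! i"
      by (auto simp: agreements_def)
    then show "u \<in> (\<Union>i\<in>{..<l} - S. cylinder n l1 (insert i S) (?w i))"
      using u by (auto simp: cylinder_def)
  qed
  have "card (A \<inter> cylinder n l1 S w)
      \<le> card (\<Union>i\<in>{..<l} - S. cylinder n l1 (insert i S) (?w i))"
    by (rule card_mono[OF _ sub]) (auto simp: finite_cylinder)
  also have "\<dots> \<le> (\<Sum>i\<in>{..<l} - S. card (cylinder n l1 (insert i S) (?w i)))"
    by (rule card_UN_le) simp
  also have "\<dots> \<le> (\<Sum>i\<in>{..<l} - S. (n + (l1 - t - 2)) choose (l1 - t - 2))"
    by (rule sum_mono, rule card_cylinder_more_le) (use S l finS in auto)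
  also have "\<dots> \<le> l * ((n + (l1 - t - 2)) choose (l1 - t - 2))"
    using S finS by (simp add: card_Diff_subset)
  finally show False
    using fat by simp
qed

text \<open>Each u agrees with v on some t-set S, hence lies in the cylinder that copies v on S. K
  stays free because two bounds are plugged in later: the full cylinder size and the threshold for
  fatness.\<close>

lemma card_le_cover_by_cylinders:
  assumes A: "A \<subseteq> weak_compositions n l1" "\<forall>u\<in>A. t \<le> card (agreements l u v)"
    and K: "\<And>S. S \<subseteq> {..<l} \<Longrightarrow> card S = t \<Longrightarrow> card (A \<inter> cylinder n l1 S ((!) v)) \<le> K"
  shows "card A \<le> (l choose t) * K"
proof -
  let ?X = "{S. S \<subseteq> {..<l} \<and> card S = t}"
  have finX: "finite ?X"
    by simp
  have sub: "A \<subseteq> (\<Union>S\<in>?X. A \<inter> cylinder n l1 S ((!) v))"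
  proof
    fix u assume u: "u \<in> A"
    then obtain S where "S \<subseteq> agreements l u v" "card S = t"
      using A(2) by (meson obtain_subset_with_card_n)
    then show "u \<in> (\<Union>S\<in>?X. A \<inter> cylinder n l1 S ((!) v))"
      using u A(1) by (auto simp: agreements_def cylinder_def intro!: exI[of _ S])
  qed
  have "card A \<le> card (\<Union>S\<in>?X. A \<inter> cylinder n l1 S ((!) v))"
    by (rule card_mono[OF _ sub]) (auto simp: finite_cylinder)
  also have "\<dots> \<le> (\<Sum>S\<in>?X. card (A \<inter> cylinder n l1 S ((!) v)))"
    by (rule card_UN_le[OF finX])
  also have "\<dots> \<le> (\<Sum>S\<in>?X. K)"
    by (rule sum_mono) (use K in auto)
  also have "\<dots> = (l choose t) * K"
    using n_subsets[of "{..<l}" t] by simp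
  finally show ?thesis .
qed

lemma card_le_of_agreements:
  assumes A: "A \<subseteq> weak_compositions n l1" "\<forall>u\<in>A. t \<le> card (agreements l u v)"
    and l: "l \<le> l1" "t + 2 \<le> l"
  shows "card A \<le> (l choose t) * ((n + (l1 - t - 1)) choose (l1 - t - 1))"
proof (rule card_le_cover_by_cylinders[OF A])
  fix S assume S: "S \<subseteq> {..<l}" "card S = t"
  have "card (A \<inter> cylinder n l1 S ((!) v)) \<le> card (cylinder n l1 S ((!) v))"
    by (rule card_mono[OF finite_cylinder]) simp
  also have "\<dots> \<le> (n + (l1 - t - 1)) choose (l1 - t - 1)"
    using card_cylinder_le[of S l1 n "(!) v"] S l by fastforce
  finally show "card (A \<inter> cylinder n l1 S ((!) v)) \<le> (n + (l1 - t - 1)) choose (l1 - t - 1)" .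
qed

lemma agreements_commute: "agreements l u v = agreements l v u"
  by (auto simp: agreements_def)

section \<open>Confining both families to one cylinder\<close>

lemma small_product_or_fat:
  assumes l: "l \<le> l1" "l \<le> l2" "t + 2 \<le> l"
    and A1: "A1 \<subseteq> weak_compositions n1 l1" and A2: "A2 \<subseteq> weak_compositions n2 l2"
    and cross: "\<forall>u\<in>A1. \<forall>v\<in>A2. t \<le> card (agreements l u v)"
    and n: "(l choose t)\<^sup>2 * l * ((n1 + (l1 - t - 2)) choose (l1 - t - 2))
             < (n1 + (l1 - t - 1)) choose (l1 - t - 1)"
    and ge: "card A1 * card A2 \<ge> ((n1 + (l1 - t - 1)) choose (l1 - t - 1)) *
                                   ((n2 + (l2 - t - 1)) choose (l2 - t - 1))"
  shows "\<exists>S w. S \<subseteq> {..<l} \<and> card S = t \<and> A2 \<subseteq> cylinder n2 l2 S w \<and>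
    card (A1 \<inter> cylinder n1 l1 S w) > l * ((n1 + (l1 - t - 2)) choose (l1 - t - 2))"
proof -
  let ?N1 = "(n1 + (l1 - t - 2)) choose (l1 - t - 2)"
  let ?M1 = "(n1 + (l1 - t - 1)) choose (l1 - t - 1)"
  let ?M2 = "(n2 + (l2 - t - 1)) choose (l2 - t - 1)"
  have pos: "?M1 > 0" "?M2 > 0"
    by simp_all
  have "card A1 * card A2 > 0"
    using ge pos by (metis less_le_trans nat_0_less_mult_iff)
  \<comment> \<open>u is the centre of the covering of A2, v that of A1; the fat cylinder found
    below takes its values from v.\<close>
  then obtain u v where u: "u \<in> A1" and v: "v \<in> A2"
    by fastforce
  have cross_v: "\<forall>u\<in>A1. t \<le> card (agreements l u v)"
    using cross v by blast
  have A2_le: "card A2 \<le> (l choose t) * ?M2"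
    by (rule card_le_of_agreements[OF A2, where v = u and l = l])
      (use cross u l agreements_commute[of l u] in auto)
  have "\<exists>S. S \<subseteq> {..<l} \<and> card S = t \<and> card (A1 \<inter> cylinder n1 l1 S ((!) v)) > l * ?N1"
  proof (rule ccontr)
    assume "\<not> ?thesis"
    then have "card A1 \<le> (l choose t) * (l * ?N1)"
      by (intro card_le_cover_by_cylinders[OF A1 cross_v]) (auto simp: not_less)
    \<comment> \<open>Each covering contributes a factor l choose t and the threshold for fatness a
      factor l, whence the constant in the hypothesis on n1.\<close>
    then have "card A1 * card A2 \<le> ((l choose t) * (l * ?N1)) * ((l choose t) * ?M2)"
      using A2_le by (rule mult_le_mono)
    also have "\<dots> = ((l choose t)\<^sup>2 * l * ?N1) * ?M2"
      by (simp add: power2_eq_square)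
    also have "\<dots> < ?M1 * ?M2"
      using n pos(2) by (rule mult_strict_right_mono)
    finally show False
      using ge by simp
  qed
  then obtain S where S: "S \<subseteq> {..<l}" "card S = t"
    and fat: "card (A1 \<inter> cylinder n1 l1 S ((!) v)) > l * ?N1"
    by blast
  have "A2 \<subseteq> cylinder n2 l2 S ((!) v)"
    using fat_cylinder_forces[OF l(1,3) S fat] cross A2 by (fastforce simp: cylinder_def)
  then show ?thesis
    using S fat by blast
qed

lemma small_product_or_common_cylinder:
  assumes l: "l \<le> l1" "l \<le> l2" "t + 2 \<le> l"
    and A1: "A1 \<subseteq> weak_compositions n1 l1" and A2: "A2 \<subseteq> weak_compositions n2 l2"
    and cross: "\<forall>u\<in>A1. \<forall>v\<in>A2. t \<le> card (agreements l u v)"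
    and n1: "(l choose t)\<^sup>2 * l * ((n1 + (l1 - t - 2)) choose (l1 - t - 2))
              < (n1 + (l1 - t - 1)) choose (l1 - t - 1)"
    and n2: "(l choose t)\<^sup>2 * l * ((n2 + (l2 - t - 2)) choose (l2 - t - 2))
              < (n2 + (l2 - t - 1)) choose (l2 - t - 1)"
    and ge: "card A1 * card A2 \<ge> ((n1 + (l1 - t - 1)) choose (l1 - t - 1)) *
                                   ((n2 + (l2 - t - 1)) choose (l2 - t - 1))"
  shows "\<exists>S w. S \<subseteq> {..<l} \<and> card S = t \<and>
    A1 \<subseteq> cylinder n1 l1 S w \<and> A2 \<subseteq> cylinder n2 l2 S w"
proof -
  let ?N1 = "(n1 + (l1 - t - 2)) choose (l1 - t - 2)"
  obtain S w where S: "S \<subseteq> {..<l}" "card S = t" and A2_sub: "A2 \<subseteq> cylinder n2 l2 S w"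
    and fat: "card (A1 \<inter> cylinder n1 l1 S w) > l * ?N1"
    using small_product_or_fat[OF l A1 A2 cross n1 ge] by blast
  have cross': "\<forall>v\<in>A2. \<forall>u\<in>A1. t \<le> card (agreements l v u)"
    using cross by (metis agreements_commute)
  have ge': "card A2 * card A1 \<ge> ((n2 + (l2 - t - 1)) choose (l2 - t - 1)) *
                                   ((n1 + (l1 - t - 1)) choose (l1 - t - 1))"
    using ge by (simp add: mult.commute)
  \<comment> \<open>Exchanging the roles of the families confines A1 as well, possibly to a
    different cylinder.\<close>
  obtain S' w' where S': "S' \<subseteq> {..<l}" "card S' = t" and A1_sub: "A1 \<subseteq> cylinder n1 l1 S' w'"
    using small_product_or_fat[OF l(2,1,3) A2 A1 cross' n2 ge'] by blast
  have fin: "finite S" "finite S'"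
    using S S' finite_subset by blast+
  have big: "card (A1 \<inter> cylinder n1 l1 S w) > ?N1"
    using fat l mult_le_mono1[of 1 l ?N1] by linarith
  have "S = S'"
  proof (rule ccontr)
    assume ne: "S \<noteq> S'"
    then have "t < card (S \<union> S')"
      using S S' fin by (metis Un_upper1 Un_upper2 card_seteq finite_UnI not_le)
    \<comment> \<open>The fat part of A1 lies in both cylinders, so its members have all coordinates
      in the union prescribed, at least t + 1 of them. On the overlap w may be chosen, since each
      such member agrees with both w and w'.\<close>
    then have le: "card (cylinder n1 l1 (S \<union> S') (\<lambda>i. if i \<in> S then w i else w' i)) \<le> ?N1"
      by (intro card_cylinder_more_le) (use S S' l in auto)
    have "card (A1 \<inter> cylinder n1 l1 S w)
        \<le> card (cylinder n1 l1 (S \<union> S') (\<lambda>i. if i \<in> S then w i else w' i))"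
      by (rule card_mono[OF finite_cylinder]) (use A1_sub in \<open>auto simp: cylinder_def\<close>)
    then show False
      using le big by simp
  qed
  \<comment> \<open>A single member of A1 in both cylinders identifies w with w' on S.\<close>
  moreover obtain u where "u \<in> A1" "u \<in> cylinder n1 l1 S w"
    using big by (metis IntE card.empty ex_in_conv not_less_zero)
  ultimately have "\<forall>i\<in>S. w i = w' i"
    using A1_sub by (auto simp: cylinder_def)
  then have "A1 \<subseteq> cylinder n1 l1 S w"
    using A1_sub \<open>S = S'\<close> by (auto simp: cylinder_def)
  then show ?thesis
    using S A2_sub by blast
qed

section \<open>The size threshold and the passage to 1-based coordinates\<close>

text \<open>By the absorption identity the quotient of the two binomials is (n + k) / k, which
  exceeds C once n is at least C * k.\<close>

lemma choose_shift_growth: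
  assumes "k > 0" and "n \<ge> C * k"
  shows "C * ((n + (k - 1)) choose (k - 1)) < ((n + k) choose k)"
proof -
  obtain j where j: "k = Suc j"
    using assms(1) gr0_implies_Suc by blast
  have "k * (C * ((n + j) choose j)) \<le> n * ((n + j) choose j)"
    using assms(2) mult_le_mono1[of "C * k" n "(n + j) choose j"] by (simp add: ac_simps)
  also have "\<dots> < Suc (n + j) * ((n + j) choose j)"
    by (rule mult_strict_right_mono) simp_all
  also have "\<dots> = k * ((n + k) choose k)"
    using Suc_times_binomial[of j "n + j"] by (simp add: j)
  finally have "k * (C * ((n + j) choose j)) < k * ((n + k) choose k)" .
  then show ?thesis
    unfolding nat_mult_less_cancel_disj by (simp add: j)
qed

lemma card_agreement_set:
  assumes "length u = l1" and "length v = l2"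
  shows "card (agreement_set u v) = card (agreements (min l1 l2) u v)"
proof -
  have "agreement_set u v = Suc ` agreements (min l1 l2) u v"
  proof (intro equalityI subsetI)
    fix i assume "i \<in> agreement_set u v"
    then show "i \<in> Suc ` agreements (min l1 l2) u v"
      using assms by (intro image_eqI[of _ _ "i - 1"])
        (auto simp: agreement_set_def agreements_def coord_def)
  qed (use assms in \<open>auto simp: agreement_set_def agreements_def coord_def\<close>)
  then show ?thesis
    by (simp add: card_image)
qed

lemma zero_cylinder_conv_coord:
  "cylinder n l S (\<lambda>_. 0) = {u \<in> weak_compositions n l. \<forall>i\<in>Suc ` S. coord u i = 0}"
  by (auto simp: cylinder_def coord_def)

section \<open>The bound and the extremal families for large n1 and n2\<close>

theorem theorem2p1:
  fixes l1 l2 t :: nat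
  assumes "l1 > 0" and "l2 > 0" and "t > 0"
    and "min l1 l2 \<ge> t + 2"
  shows "\<exists>n0::nat. \<forall>n1 n2 :: nat. n1 \<ge> n0 \<longrightarrow> n2 \<ge> n0 \<longrightarrow>
    (\<forall>A1 A2. A1 \<subseteq> weak_compositions n1 l1 \<longrightarrow> A2 \<subseteq> weak_compositions n2 l2 \<longrightarrow>
       cross_intersecting t A1 A2 \<longrightarrow>
       card A1 * card A2 \<le>
         ((n1 + l1 - t - 1) choose (l1 - t - 1)) * ((n2 + l2 - t - 1) choose (l2 - t - 1)) \<and>
       (card A1 * card A2 =
          ((n1 + l1 - t - 1) choose (l1 - t - 1)) * ((n2 + l2 - t - 1) choose (l2 - t - 1)) \<longleftrightarrow>
        (\<exists>T. T \<subseteq> {1..min l1 l2} \<and> card T = t \<and>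
           A1 = {u \<in> weak_compositions n1 l1. \<forall>i\<in>T. coord u i = 0} \<and>
           A2 = {u \<in> weak_compositions n2 l2. \<forall>i\<in>T. coord u i = 0})))"
proof -
  define l where "l = min l1 l2"
  define C where "C = (l choose t)\<^sup>2 * l"
  define M where "M = (\<lambda>n l. (n + l - t - 1) choose (l - t - 1))"
  have l: "l \<le> l1" "l \<le> l2" "t + 2 \<le> l"
    using assms by (auto simp: l_def)
  \<comment> \<open>Regrouping the truncated subtractions is legitimate because t + 2 \<le>
    l'.\<close>
  have M_eq: "M n l' = (n + (l' - t - 1)) choose (l' - t - 1)" if "l \<le> l'" for n l'
    using that l by (simp add: M_def add.commute)
  have M_pos: "M n l' > 0" if "l \<le> l'" for n l'
    using that by (simp add: M_eq)
  \<comment> \<open>The lower index l' - t - 1 is at most l1 + l2 for both families, so the single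
    threshold C * (l1 + l2) serves as n0.\<close>
  have growth: "(l choose t)\<^sup>2 * l * ((n + (l' - t - 2)) choose (l' - t - 2))
      < (n + (l' - t - 1)) choose (l' - t - 1)" if "n \<ge> C * (l1 + l2)" "l \<le> l'" "l' \<le> l1 + l2" for n l'
  proof -
    have "C * (l' - t - 1) \<le> C * (l1 + l2)"
      using that by (intro mult_le_mono2) simp
    then have "C * ((n + (l' - t - 1 - 1)) choose (l' - t - 1 - 1))
        < (n + (l' - t - 1)) choose (l' - t - 1)"
      by (intro choose_shift_growth) (use that l in linarith)+
    moreover have "l' - t - 1 - 1 = l' - t - 2"
      by simp
    ultimately show ?thesis
      by (simp only: C_def)
  qed
  have card_le: "card (cylinder n l' S w) \<le> M n l'"
    if "S \<subseteq> {..<l}" "card S = t" "l \<le> l'" for n l' S w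
    using card_cylinder_le[of S l' n w] that l by (fastforce simp: M_eq)
  have card_zero: "card (cylinder n l' S (\<lambda>_. 0)) = M n l'"
    if "S \<subseteq> {..<l}" "card S = t" "l \<le> l'" for n l' S
  proof -
    have "S \<subseteq> {..<l'}" "card S < l'"
      using that l by auto
    from card_cylinder[OF this, of n "\<lambda>_. 0"] show ?thesis
      using that by (simp add: M_eq)
  qed
  show ?thesis
  proof (intro exI[of _ "C * (l1 + l2)"] allI impI)
    fix n1 n2 A1 A2
    assume n: "n1 \<ge> C * (l1 + l2)" "n2 \<ge> C * (l1 + l2)"
      and A1: "A1 \<subseteq> weak_compositions n1 l1" and A2: "A2 \<subseteq> weak_compositions n2 l2"
      and cross: "cross_intersecting t A1 A2"
    let ?opt = "\<exists>T. T \<subseteq> {1..min l1 l2} \<and> card T = t \<and>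
           A1 = {u \<in> weak_compositions n1 l1. \<forall>i\<in>T. coord u i = 0} \<and>
           A2 = {u \<in> weak_compositions n2 l2. \<forall>i\<in>T. coord u i = 0}"
    have cross': "\<forall>u\<in>A1. \<forall>v\<in>A2. t \<le> card (agreements l u v)"
    proof (intro ballI)
      fix u v assume uv: "u \<in> A1" "v \<in> A2"
      then have "length u = l1" "length v = l2"
        using A1 A2 by (auto simp: weak_compositions_def)
      then show "t \<le> card (agreements l u v)"
        using cross uv card_agreement_set[of u l1 v l2]
        by (fastforce simp: cross_intersecting_def l_def)
    qed
    \<comment> \<open>This yields both the upper bound and one direction of the equality case: a
      product that reaches the bound equals it and comes from an extremal pair.\<close>
    have large: "card A1 * card A2 = M n1 l1 * M n2 l2 \<and> ?opt"
      if ge: "card A1 * card A2 \<ge> M n1 l1 * M n2 l2"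
    proof -
      obtain S w where S: "S \<subseteq> {..<l}" "card S = t"
        and sub: "A1 \<subseteq> cylinder n1 l1 S w" "A2 \<subseteq> cylinder n2 l2 S w"
        using small_product_or_common_cylinder[OF l A1 A2 cross' growth[OF n(1)] growth[OF n(2)]] ge l
        by (auto simp: M_eq)
      have le: "card A1 \<le> card (cylinder n1 l1 S w)" "card A2 \<le> card (cylinder n2 l2 S w)"
        using sub by (auto intro: card_mono finite_cylinder)
      have le_M: "card A1 \<le> M n1 l1" "card A2 \<le> M n2 l2"
        using le card_le[OF S] l by (meson le_trans)+
      have pos: "M n1 l1 > 0" "M n2 l2 > 0"
        using M_pos l by blast+
      \<comment> \<open>Neither factor exceeds its positive maximum while the product is at least
        the product of the maxima, so both are attained.\<close>
      have eq: "card A1 = M n1 l1" "card A2 = M n2 l2"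
      proof -
        have "\<not> card A1 < M n1 l1"
          using mult_strict_right_mono[of "card A1" "M n1 l1" "M n2 l2"]
            mult_le_mono2[of "card A2" "M n2 l2" "card A1"] le_M pos ge by linarith
        then show "card A1 = M n1 l1"
          using le_M by simp
        then show "card A2 = M n2 l2"
          using ge pos le_M by simp
      qed
      \<comment> \<open>Maximality of A1 alone makes w vanish on S; since w is common to both
        cylinders, this settles A2 too.\<close>
      have "\<forall>i\<in>S. w i = 0"
        using card_cylinder_eq_max[of S l1 n1 w] S l le(1) eq(1) by (fastforce simp: M_eq)
      then have w0: "cylinder n l' S w = cylinder n l' S (\<lambda>_. 0)" for n l'
        by (auto simp: cylinder_def)
      \<comment> \<open>Each family is contained in a finite zero cylinder of the same
        cardinality.\<close>
      have "A1 = cylinder n1 l1 S (\<lambda>_. 0)" "A2 = cylinder n2 l2 S (\<lambda>_. 0)"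
        using sub eq card_zero[OF S] l by (simp_all add: w0 card_subset_eq finite_cylinder)
      moreover have "Suc ` S \<subseteq> {1..min l1 l2}" "card (Suc ` S) = t"
        using S by (auto simp: l_def card_image)
      ultimately have ?opt
        unfolding zero_cylinder_conv_coord by blast
      then show ?thesis
        using eq by simp
    qed
    have opt_eq: "card A1 * card A2 = M n1 l1 * M n2 l2" if opt: ?opt
    proof -
      obtain T where T: "T \<subseteq> {1..min l1 l2}" "card T = t"
        and A: "A1 = {u \<in> weak_compositions n1 l1. \<forall>i\<in>T. coord u i = 0}"
          "A2 = {u \<in> weak_compositions n2 l2. \<forall>i\<in>T. coord u i = 0}"
        using opt by blast
      have "T \<subseteq> Suc ` {..<l}"
        using T by (simp add: image_Suc_lessThan l_def)
      then obtain S where S: "S \<subseteq> {..<l}" "T = Suc ` S"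
        by (meson subset_imageE)
      have "card S = t"
        using S T by (simp add: card_image)
      then show ?thesis
        using A card_zero[OF S(1)] l unfolding S(2) zero_cylinder_conv_coord[symmetric] by simp
    qed
    have "card A1 * card A2 \<le> M n1 l1 * M n2 l2 \<and>
        (card A1 * card A2 = M n1 l1 * M n2 l2 \<longleftrightarrow> ?opt)"
    proof (cases "card A1 * card A2 \<ge> M n1 l1 * M n2 l2")
      case True
      show ?thesis
        by (intro conjI iffI eq_refl) (rule large[OF True, THEN conjunct1] large[OF True, THEN conjunct2])+
    next
      \<comment> \<open>Below the bound, both sides of the equivalence are false, the right one by
        \<open>opt_eq\<close>.\<close>
      case False
      then have less: "card A1 * card A2 < M n1 l1 * M n2 l2"
        by simp
      have "\<not> ?opt"
      proof
        assume ?opt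
        then have "card A1 * card A2 = M n1 l1 * M n2 l2"
          by (rule opt_eq)
        then show False
          using less by simp
      qed
      then show ?thesis
        using less by (simp only: less_imp_le less_imp_neq simp_thms)
    qed
    then show "card A1 * card A2 \<le>
         ((n1 + l1 - t - 1) choose (l1 - t - 1)) * ((n2 + l2 - t - 1) choose (l2 - t - 1)) \<and>
       (card A1 * card A2 =
          ((n1 + l1 - t - 1) choose (l1 - t - 1)) * ((n2 + l2 - t - 1) choose (l2 - t - 1)) \<longleftrightarrow> ?opt)"
      by (simp only: M_def)
  qed
qed

end
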